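(* There is an absolute constant $C>0$ such that the following holds. Let $\mathcal{Q}=\{q_i\}_{i=1}^n$ be a set of queries and $\mathcal{D}=\{x_j\}_{j=1}^m$ a set of documents forming a Hierarchical Retrieval problem with directed acyclic graph $\mathcal{G}=(\mathcal{V},\mathcal{E})$, $\mathcal{V}=\mathcal{D}$, exact match map $E:\mathcal{Q}\to\mathcal{D}$, and relevant document sets $S(q_i)=\{x\in\mathcal{D}: x \text{ is reachable from } E(q_i) \text{ in } \mathcal{G}\}$. Fix any $\epsilon\in(0,1/2)$, and assume that $|S(q_i)|\le s$ for all $i\in[n]$, for some integer $s$. Then there exist a dimension $d$ with $$d\le C\cdot\max\left\{s\log m,\ \tfrac{1}{\epsilon^2}\log m\right\},$$ a threshold $r\in\mathbb{R}$ (the same for all queries), and vectors $\{\boldsymbol{q}_i\}_{i=1}^n,\ \{\boldsymbol{x}_j\}_{j=1}^m\subset\mathbb{R}^d$ such that for all $i\in[n]$ and $j\in[m]$: (1) if $x_j\in S(q_i)$, then $\langle\boldsymbol{q}_i,\boldsymbol{x}_j\rangle\ge r+\epsilon$; (2) if $x_j\notin S(q_i)$, then $\langle\boldsymbol{q}_i,\boldsymbol{x}_j\rangle\le r-\epsilon$. Moreover, vectors $\{\boldsymbol{q}_i\}_{i=1}^n,\{\boldsymbol{x}_j\}_{j=1}^m$ satisfying these properties can be constructed, with high probability, by a randomized algorithm running in time $\tilde{O}(md+nsd)$.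
   Context: Hierarchical Retrieval (HR) problem: $\mathcal{Q}=\{q_i\}_{i=1}^n$ is a finite collection of $n$ queries and $\mathcal{D}=\{x_j\}_{j=1}^m$ a finite collection of $m$ documents. There is a directed acyclic graph $\mathcal{G}=(\mathcal{V},\mathcal{E})$ on the document set, i.e. $\mathcal{V}=\mathcal{D}$ and $\mathcal{E}\subseteq\mathcal{V}\times\mathcal{V}$, and a map $E:\mathcal{Q}\to\mathcal{D}$, where $E(q_i)$ is called the exact match of $q_i$. The set of relevant documents for $q_i$ is $S(q_i)=\{x\in\mathcal{D}: x\text{ is reachable from }E(q_i)\text{ by a directed path in }\mathcal{G}\}$; the trivial path is allowed, so $E(q_i)\in S(q_i)$. Notation: $[k]=\{1,\dots,k\}$; $\langle\cdot,\cdot\rangle$ is the standard Euclidean inner product on $\mathbb{R}^d$. The vector $\boldsymbol{q}_i$ is the embedding of query $q_i$ and $\boldsymbol{x}_j$ is the embedding of document $x_j$. Conventions for the algorithmic part: the algorithm receives as input $\mathcal{Q}$, $\mathcal{D}$ and the relevant sets $S(q_1),\dots,S(q_n)$ (and $\epsilon$, $s$); time counts arithmetic operations on real numbers and draws of independent standard Gaussian random variables at unit cost; $\tilde{O}(\cdot)$ hides polylogarithmic factors; "with high probability" has its usual meaning of probability at least $1-1/\mathrm{poly}(m)$ over the randomness of the algorithm. *)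

theory Defs
  imports "HOL-Probability.Probability" "Jordan_Normal_Form.Matrix"
begin

section \<open>Hierarchical retrieval\<close>

text \<open>The query $q_i$ is represented by its index $i \in \{1..n\}$ and the document $x_j$ by its index
  $j \in \{1..m\}$.  Working over the fixed type \<^typ>\<open>nat\<close> rather than over type variables is what
  makes the constants in the theorem absolute: constants chosen underneath a free type variable
  could depend on that type.\<close>

definition hierarchical_retrieval ::
    "nat \<Rightarrow> nat \<Rightarrow> (nat \<times> nat) set \<Rightarrow> (nat \<Rightarrow> nat) \<Rightarrow> bool" where
  "hierarchical_retrieval n m G E \<longleftrightarrow>
     G \<subseteq> {1..m} \<times> {1..m} \<and> acyclic G \<and> E \<in> {1..n} \<rightarrow> {1..m}"

definition relevant :: "nat \<Rightarrow> (nat \<times> nat) set \<Rightarrow> (nat \<Rightarrow> nat) \<Rightarrow> nat \<Rightarrow> nat set" where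
  "relevant m G E i = {j \<in> {1..m}. (E i, j) \<in> G\<^sup>*}"

definition separating_embedding ::
    "nat \<Rightarrow> nat \<Rightarrow> (nat \<Rightarrow> nat set) \<Rightarrow> real \<Rightarrow> nat \<Rightarrow> real
      \<Rightarrow> (nat \<Rightarrow> real Matrix.vec) \<Rightarrow> (nat \<Rightarrow> real Matrix.vec) \<Rightarrow> bool" where
  "separating_embedding n m S \<epsilon> d r q x \<longleftrightarrow>
     (\<forall>i\<in>{1..n}. q i \<in> carrier_vec d) \<and> (\<forall>j\<in>{1..m}. x j \<in> carrier_vec d) \<and>
     (\<forall>i\<in>{1..n}. \<forall>j\<in>{1..m}.
        (j \<in> S i \<longrightarrow> scalar_prod (q i) (x j) \<ge> r + \<epsilon>) \<and>
        (j \<notin> S i \<longrightarrow> scalar_prod (q i) (x j) \<le> r - \<epsilon>))"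


section \<open>Randomized algorithms on a real RAM\<close>

text \<open>Programs are finite syntactic objects of an imperative language over cells holding exact real
  numbers and cells holding natural numbers; the latter serve for counting and for indexing.
  A cell is addressed by an array name and a list of computed indices: \<open>[]\<close> for a scalar, \<open>[i]\<close> for
  an entry of a vector, \<open>[j, k]\<close> for an entry of a matrix, and so on.  The only literals are
  natural numbers, so that no information can be hidden in a real constant.\<close>

datatype nexp =
    NLit nat
  | NCell string "nexp list"
  | NAdd nexp nexp
  | NSub nexp nexp
  | NMul nexp nexp

datatype rexp =
    ROfNat nexp
  | RCell string "nexp list"
  | RAdd rexp rexp
  | RSub rexp rexp
  | RMul rexp rexp
  | RDiv rexp rexp

datatype bexp =
    NLess nexp nexp
  | RLess rexp rexp
  | BNot bexp
  | BAnd bexp bexp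

datatype com =
    Skip
  | NAssign string "nexp list" nexp
  | RAssign string "nexp list" rexp
  | Gauss string "nexp list"  \<comment> \<open>store a fresh standard Gaussian in a real cell\<close>
  | Seq com com
  | Cond bexp com com
  | While bexp com

text \<open>The component \<open>tape\<close> is the sequence of the values that the future Gaussian draws will return.\<close>

record state =
  nmem :: "string \<Rightarrow> nat list \<Rightarrow> nat"
  rmem :: "string \<Rightarrow> nat list \<Rightarrow> real"
  tape :: "nat \<Rightarrow> real"

fun nval :: "state \<Rightarrow> nexp \<Rightarrow> nat" where
  "nval \<sigma> (NLit c) = c"
| "nval \<sigma> (NCell a is) = nmem \<sigma> a (map (nval \<sigma>) is)"
| "nval \<sigma> (NAdd e f) = nval \<sigma> e + nval \<sigma> f"
| "nval \<sigma> (NSub e f) = nval \<sigma> e - nval \<sigma> f"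
| "nval \<sigma> (NMul e f) = nval \<sigma> e * nval \<sigma> f"

fun rval :: "state \<Rightarrow> rexp \<Rightarrow> real" where
  "rval \<sigma> (ROfNat e) = real (nval \<sigma> e)"
| "rval \<sigma> (RCell a is) = rmem \<sigma> a (map (nval \<sigma>) is)"
| "rval \<sigma> (RAdd e f) = rval \<sigma> e + rval \<sigma> f"
| "rval \<sigma> (RSub e f) = rval \<sigma> e - rval \<sigma> f"
| "rval \<sigma> (RMul e f) = rval \<sigma> e * rval \<sigma> f"
| "rval \<sigma> (RDiv e f) = rval \<sigma> e / rval \<sigma> f"

fun bval :: "state \<Rightarrow> bexp \<Rightarrow> bool" where
  "bval \<sigma> (NLess e f) \<longleftrightarrow> nval \<sigma> e < nval \<sigma> f"
| "bval \<sigma> (RLess e f) \<longleftrightarrow> rval \<sigma> e < rval \<sigma> f"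
| "bval \<sigma> (BNot b) \<longleftrightarrow> \<not> bval \<sigma> b"
| "bval \<sigma> (BAnd b c) \<longleftrightarrow> bval \<sigma> b \<and> bval \<sigma> c"

text \<open>Time: every node of an expression that is evaluated (literal, memory access, arithmetic
  operation, comparison, Boolean connective) and every command that is executed costs one unit.
  Hence the time dominates the number of arithmetic operations plus the number of
  Gaussian draws.\<close>

fun ncost :: "nexp \<Rightarrow> nat" where
  "ncost (NLit c) = 1"
| "ncost (NCell a is) = 1 + sum_list (map ncost is)"
| "ncost (NAdd e f) = 1 + ncost e + ncost f"
| "ncost (NSub e f) = 1 + ncost e + ncost f"
| "ncost (NMul e f) = 1 + ncost e + ncost f"

fun rcost :: "rexp \<Rightarrow> nat" where
  "rcost (ROfNat e) = 1 + ncost e"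
| "rcost (RCell a is) = 1 + sum_list (map ncost is)"
| "rcost (RAdd e f) = 1 + rcost e + rcost f"
| "rcost (RSub e f) = 1 + rcost e + rcost f"
| "rcost (RMul e f) = 1 + rcost e + rcost f"
| "rcost (RDiv e f) = 1 + rcost e + rcost f"

fun bcost :: "bexp \<Rightarrow> nat" where
  "bcost (NLess e f) = 1 + ncost e + ncost f"
| "bcost (RLess e f) = 1 + rcost e + rcost f"
| "bcost (BNot b) = 1 + bcost b"
| "bcost (BAnd b c) = 1 + bcost b + bcost c"

definition nstore :: "string \<Rightarrow> nat list \<Rightarrow> nat \<Rightarrow> state \<Rightarrow> state" where
  "nstore a is v \<sigma> = \<sigma>\<lparr>nmem := (nmem \<sigma>)(a := (nmem \<sigma> a)(is := v))\<rparr>"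

definition rstore :: "string \<Rightarrow> nat list \<Rightarrow> real \<Rightarrow> state \<Rightarrow> state" where
  "rstore a is v \<sigma> = \<sigma>\<lparr>rmem := (rmem \<sigma>)(a := (rmem \<sigma> a)(is := v))\<rparr>"

text \<open>\<open>exec c \<sigma> t \<tau>\<close>: started in \<open>\<sigma>\<close>, the program \<open>c\<close> halts after exactly \<open>t\<close> units of time,
  in state \<open>\<tau>\<close>.\<close>

inductive exec :: "com \<Rightarrow> state \<Rightarrow> nat \<Rightarrow> state \<Rightarrow> bool" where
  Skip: "exec Skip \<sigma> 1 \<sigma>"
| NAssign: "exec (NAssign a is e) \<sigma> (1 + sum_list (map ncost is) + ncost e)
     (nstore a (map (nval \<sigma>) is) (nval \<sigma> e) \<sigma>)"
| RAssign: "exec (RAssign a is e) \<sigma> (1 + sum_list (map ncost is) + rcost e)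
     (rstore a (map (nval \<sigma>) is) (rval \<sigma> e) \<sigma>)"
| Gauss: "exec (Gauss a is) \<sigma> (1 + sum_list (map ncost is))
     ((rstore a (map (nval \<sigma>) is) (tape \<sigma> 0) \<sigma>)\<lparr>tape := (\<lambda>k. tape \<sigma> (Suc k))\<rparr>)"
| Seq: "exec c \<sigma> t \<sigma>' \<Longrightarrow> exec c' \<sigma>' t' \<sigma>'' \<Longrightarrow> exec (Seq c c') \<sigma> (1 + t + t') \<sigma>''"
| CondTrue: "bval \<sigma> b \<Longrightarrow> exec c \<sigma> t \<sigma>' \<Longrightarrow> exec (Cond b c c') \<sigma> (1 + bcost b + t) \<sigma>'"
| CondFalse: "\<not> bval \<sigma> b \<Longrightarrow> exec c' \<sigma> t \<sigma>' \<Longrightarrow> exec (Cond b c c') \<sigma> (1 + bcost b + t) \<sigma>'"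
| WhileFalse: "\<not> bval \<sigma> b \<Longrightarrow> exec (While b c) \<sigma> (1 + bcost b) \<sigma>"
| WhileTrue: "bval \<sigma> b \<Longrightarrow> exec c \<sigma> t \<sigma>' \<Longrightarrow> exec (While b c) \<sigma>' t' \<sigma>''
     \<Longrightarrow> exec (While b c) \<sigma> (1 + bcost b + t + t') \<sigma>''"

inductive_cases SkipE: "exec Skip \<sigma> t \<tau>"
inductive_cases NAssignE: "exec (NAssign a is e) \<sigma> t \<tau>"
inductive_cases RAssignE: "exec (RAssign a is e) \<sigma> t \<tau>"
inductive_cases GaussE: "exec (Gauss a is) \<sigma> t \<tau>"
inductive_cases SeqE: "exec (Seq c c') \<sigma> t \<tau>"
inductive_cases CondE: "exec (Cond b c c') \<sigma> t \<tau>"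
inductive_cases WhileE: "exec (While b c) \<sigma> t \<tau>"

text \<open>For a fixed tape the execution is deterministic, so the tape is the only randomness.\<close>

lemma exec_deterministic:
  "exec c \<sigma> t \<tau> \<Longrightarrow> exec c \<sigma> t' \<tau>' \<Longrightarrow> t' = t \<and> \<tau>' = \<tau>"
proof (induction arbitrary: t' \<tau>' rule: exec.induct)
  case (Seq c \<sigma> t \<sigma>' c' t2 \<sigma>'')
  from Seq.prems show ?case
    by (rule SeqE) (auto dest!: Seq.IH)
next
  case (CondTrue b \<sigma> c t \<sigma>' c')
  from CondTrue.prems show ?case
    by (rule CondE) (use CondTrue.hyps(1) in \<open>auto dest!: CondTrue.IH\<close>)
next
  case (CondFalse b \<sigma> c' t \<sigma>' c)
  from CondFalse.prems show ?case
    by (rule CondE) (use CondFalse.hyps(1) in \<open>auto dest!: CondFalse.IH\<close>)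
next
  case (WhileFalse b \<sigma> c)
  from WhileFalse.prems show ?case
    by (rule WhileE) (use WhileFalse.hyps in auto)
next
  case (WhileTrue b \<sigma> c t \<sigma>' t2 \<sigma>'')
  from WhileTrue.prems show ?case
    by (rule WhileE) (use WhileTrue.hyps(1) in \<open>auto dest!: WhileTrue.IH\<close>)
qed (auto elim: SkipE NAssignE RAssignE GaussE)

definition gaussian_tape :: "(nat \<Rightarrow> real) measure" where
  "gaussian_tape = (\<Pi>\<^sub>M k\<in>UNIV. density lborel (\<lambda>z. ennreal (std_normal_density z)))"

text \<open>The input consists of \<open>n\<close>, \<open>m\<close>, \<open>s\<close>, \<open>\<epsilon>\<close> and the relevant sets; neither the graph nor the exact
  match map is passed to the algorithm.  The set \<open>S i\<close> is given by its cardinality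
  \<open>size[i]\<close> and by its elements \<open>S[i,0], \<dots>, S[i,size[i]-1]\<close>, listed in increasing order.
  All other cells are initially zero.\<close>

definition initial_state ::
    "nat \<Rightarrow> nat \<Rightarrow> (nat \<Rightarrow> nat set) \<Rightarrow> real \<Rightarrow> nat \<Rightarrow> (nat \<Rightarrow> real) \<Rightarrow> state" where
  "initial_state n m S \<epsilon> s \<omega> =
     \<lparr>nmem = (\<lambda>a is.
        if a = ''n'' \<and> is = [] then n
        else if a = ''m'' \<and> is = [] then m
        else if a = ''s'' \<and> is = [] then s
        else if a = ''size'' \<and> (\<exists>i\<in>{1..n}. is = [i]) then card (S (is ! 0))
        else if a = ''S'' \<and> (\<exists>i\<in>{1..n}. \<exists>l<card (S i). is = [i, l])
          then sorted_list_of_set (S (is ! 0)) ! (is ! 1)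
        else 0),
      rmem = (\<lambda>a is. if a = ''eps'' \<and> is = [] then \<epsilon> else 0),
      tape = \<omega>\<rparr>"

text \<open>Output convention: the dimension in the scalar \<open>d\<close>, the vectors as the rows of the
  real matrices \<open>q\<close> and \<open>x\<close> (rows counted from 1, coordinates from 0).\<close>

definition output_dim :: "state \<Rightarrow> nat" where
  "output_dim \<sigma> = nmem \<sigma> ''d'' []"

definition output_query :: "state \<Rightarrow> nat \<Rightarrow> real Matrix.vec" where
  "output_query \<sigma> i = Matrix.vec (output_dim \<sigma>) (\<lambda>k. rmem \<sigma> ''q'' [i, k])"

definition output_doc :: "state \<Rightarrow> nat \<Rightarrow> real Matrix.vec" where
  "output_doc \<sigma> j = Matrix.vec (output_dim \<sigma>) (\<lambda>k. rmem \<sigma> ''x'' [j, k])"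

text \<open>\<open>soft_bound K k g\<close> is the generic member of $\tilde O(g)$.  The \<open>max\<close> only matters for \<open>g < 1\<close>
  (for example \<open>d = 0\<close>), where it allows constant time.\<close>

definition soft_bound :: "real \<Rightarrow> nat \<Rightarrow> real \<Rightarrow> real" where
  "soft_bound K k g = K * max 1 g * (1 + ln (max 1 g)) ^ k"

end

theory Submission
  imports Defs "HOL-Computational_Algebra.Polynomial"
begin

text \<open>The vectors need not be normalized, so no randomness is needed.  Put the documents on the
  moment curve, $x_j = (1, j, j^2, \ldots, j^{2s})$, and let $q_i$ list the coefficients of
  $p_i = - \prod_{a \in S(q_i)} (X - a)^2$, of degree at most $2s$.  Then
  $\langle q_i, x_j \rangle = p_i(j)$ vanishes for $j \in S(q_i)$ and is at most $-1$ otherwise, so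
  $r = -1/2$ separates with margin $1/2 > \epsilon$ in dimension $2s + 1$.  Multiplying out one
  quadratic factor at a time takes $O(sd)$ steps per query.  If $m \le 1$ then $\log m = 0$
  forces dimension $0$, which suffices as every document is then relevant to every query.\<close>

section \<open>Polynomials with prescribed double roots\<close>

text \<open>Only the first \<open>l\<close> roots enter, so that passing from \<open>l\<close> to
  \<open>Suc l\<close> is one pass of \<open>factor_prog\<close>. The minus sign puts relevant
  documents on the high side of the threshold.\<close>

definition root_poly :: "(nat \<Rightarrow> nat) \<Rightarrow> nat \<Rightarrow> real poly" where
  "root_poly a l = - (\<Prod>t<l. [:- real (a t), 1:]\<^sup>2)"

lemma root_poly_Suc:
  "root_poly a (Suc l) = root_poly a l * [:(real (a l))\<^sup>2, - 2 * real (a l), 1:]"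
  by (simp add: root_poly_def power2_eq_square algebra_simps)

lemma degree_root_poly: "degree (root_poly a l) \<le> 2 * l"
proof (induction l)
  case (Suc l)
  have "degree (root_poly a (Suc l)) \<le>
    degree (root_poly a l) + degree [:(real (a l))\<^sup>2, - 2 * real (a l), 1:]"
    unfolding root_poly_Suc by (rule degree_mult_le)
  with Suc show ?case by simp
qed (simp add: root_poly_def)

lemma poly_root_poly: "poly (root_poly a l) z = - (\<Prod>t<l. (z - real (a t))\<^sup>2)"
  by (simp add: root_poly_def poly_prod)

text \<open>The shift by $X^2$ makes the recurrence for the coefficients uniform in the index.\<close>

definition shifted_coeff :: "(nat \<Rightarrow> nat) \<Rightarrow> nat \<Rightarrow> nat \<Rightarrow> real" where
  "shifted_coeff a l p = coeff (pCons 0 (pCons 0 (root_poly a l))) p"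

lemma shifted_coeff_low: "p < 2 \<Longrightarrow> shifted_coeff a l p = 0"
  by (auto simp: shifted_coeff_def less_2_cases_iff)

lemma shifted_coeff_add2: "shifted_coeff a l (Suc (Suc k)) = coeff (root_poly a l) k"
  by (simp add: shifted_coeff_def)

lemma shifted_coeff_0: "shifted_coeff a 0 p = (if p = 2 then - 1 else 0)"
  by (cases p rule: nat.exhaust; cases "p - 1")
    (auto simp: shifted_coeff_def root_poly_def coeff_pCons split: nat.splits)

text \<open>Comparison of coefficients in the product with X^2 - 2aX + a^2 for a =
  \<open>a l\<close>. Thanks to the shift there is no boundary case at k = 0 or k = 1, so the loop
  body needs no branch.\<close>

lemma shifted_coeff_Suc:
  "shifted_coeff a (Suc l) (Suc (Suc k)) = shifted_coeff a l k
    - 2 * real (a l) * shifted_coeff a l (Suc k) + (real (a l))\<^sup>2 * shifted_coeff a l (Suc (Suc k))"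
  by (simp add: shifted_coeff_def root_poly_Suc coeff_pCons algebra_simps split: nat.splits)

text \<open>The shift raises the degree bound to 2l + 2. This accounts for the cells past the end of
  the inner loop, which stay 0.\<close>

lemma shifted_coeff_high: "2 * l + 2 < p \<Longrightarrow> shifted_coeff a l p = 0"
  using degree_root_poly[of a l]
  by (auto simp: shifted_coeff_def coeff_pCons coeff_eq_0 split: nat.splits)

text \<open>Pairing coefficients with powers of z is evaluation at z; the hypothesis ensures that
  truncation at \<open>d\<close> drops only zero coefficients.\<close>

lemma sum_coeff_root_poly:
  assumes "2 * l < d"
  shows "(\<Sum>k<d. coeff (root_poly a l) k * z ^ k) = - (\<Prod>t<l. (z - real (a t))\<^sup>2)"
proof -
  have "(\<Sum>k<d. coeff (root_poly a l) k * z ^ k) = poly (root_poly a l) z"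
    unfolding poly_altdef using degree_root_poly[of a l] assms
    by (intro sum.mono_neutral_right) (auto simp: coeff_eq_0)
  then show ?thesis by (simp add: poly_root_poly)
qed

lemma root_poly_zero:
  fixes a :: "nat \<Rightarrow> nat"
  assumes "t < l"
  shows "- (\<Prod>t'<l. (real (a t) - real (a t'))\<^sup>2) = 0"
proof -
  have "(\<Prod>t'<l. (real (a t) - real (a t'))\<^sup>2) = 0"
    using assms by (intro prod_zero bexI[of _ t]) auto
  then show ?thesis by simp
qed

text \<open>Distinct natural numbers differ by at least 1, so every squared factor is at least 1.
  This integrality is the source of the margin.\<close>

lemma root_poly_le_minus_1:
  fixes a :: "nat \<Rightarrow> nat"
  assumes "\<And>t. t < l \<Longrightarrow> a t \<noteq> j"
  shows "- (\<Prod>t<l. (real j - real (a t))\<^sup>2) \<le> - 1"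
proof -
  have "1 \<le> (real j - real (a t))\<^sup>2" if "t < l" for t
  proof -
    have "1 \<le> \<bar>int j - int (a t)\<bar>" using assms[OF that] by linarith
    then have "1 \<le> \<bar>real j - real (a t)\<bar>" by linarith
    then show ?thesis by (metis one_le_power power2_abs)
  qed
  then have "1 \<le> (\<Prod>t<l. (real j - real (a t))\<^sup>2)" by (intro prod_ge_1) auto
  then show ?thesis by simp
qed

section \<open>Time-bounded total correctness\<close>

text \<open>Since \<open>exec\<close> is deterministic, the existential form already expresses total
  correctness. An upper bound in place of the exact time allows costs to be rounded up.\<close>

definition runs :: "com \<Rightarrow> state \<Rightarrow> nat \<Rightarrow> (state \<Rightarrow> bool) \<Rightarrow> bool" where
  "runs c \<sigma> T Q \<longleftrightarrow> (\<exists>t \<tau>. exec c \<sigma> t \<tau> \<and> t \<le> T \<and> Q \<tau>)"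

lemma runs_mono:
  assumes "runs c \<sigma> T Q" "T \<le> T'" "\<And>\<tau>. Q \<tau> \<Longrightarrow> Q' \<tau>"
  shows "runs c \<sigma> T' Q'"
  using assms unfolding runs_def by (meson le_trans)

lemma runs_Seq:
  assumes "runs c \<sigma> T Q" "\<And>\<tau>. Q \<tau> \<Longrightarrow> runs c' \<tau> T' R" "1 + T + T' \<le> U"
  shows "runs (Seq c c') \<sigma> U R"
proof -
  obtain t \<tau> where 1: "exec c \<sigma> t \<tau>" "t \<le> T" "Q \<tau>" using assms(1) by (auto simp: runs_def)
  with assms(2) obtain t' \<tau>' where 2: "exec c' \<tau> t' \<tau>'" "t' \<le> T'" "R \<tau>'"
    unfolding runs_def by blast
  have "1 + t + t' \<le> U" using 1(2) 2(2) assms(3) by linarith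
  with exec.Seq[OF 1(1) 2(1)] 2(3) show ?thesis unfolding runs_def by blast
qed

lemma runs_NAssign:
  assumes "Q (nstore a (map (nval \<sigma>) is) (nval \<sigma> e) \<sigma>)"
    and "1 + sum_list (map ncost is) + ncost e \<le> T"
  shows "runs (NAssign a is e) \<sigma> T Q"
  unfolding runs_def using exec.NAssign assms by blast

lemma runs_RAssign:
  assumes "Q (rstore a (map (nval \<sigma>) is) (rval \<sigma> e) \<sigma>)"
    and "1 + sum_list (map ncost is) + rcost e \<le> T"
  shows "runs (RAssign a is e) \<sigma> T Q"
  unfolding runs_def using exec.RAssign assms by blast

text \<open>The invariant is indexed by the progress of the loop, and the induction is on the number
  \<open>N - k\<close> of remaining rounds. The last summand pays for the failing test.\<close>

lemma runs_While:
  assumes "\<And>k \<tau>. k < N \<Longrightarrow> I k \<tau> \<Longrightarrow> bval \<tau> b \<and> runs c \<tau> T (I (Suc k))"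
    and "\<And>\<tau>. I N \<tau> \<Longrightarrow> \<not> bval \<tau> b" and "k \<le> N" "I k \<sigma>"
  shows "runs (While b c) \<sigma> ((N - k) * (1 + bcost b + T) + (1 + bcost b)) (I N)"
  using assms(3,4)
proof (induction "N - k" arbitrary: k \<sigma>)
  case 0
  then have "k = N" by simp
  with 0 have "exec (While b c) \<sigma> (1 + bcost b) \<sigma>" using assms(2) exec.WhileFalse by blast
  with 0 \<open>k = N\<close> show ?case unfolding runs_def by force
next
  case (Suc p)
  then have k: "k < N" by simp
  with Suc.prems assms(1) obtain t \<tau>
    where *: "bval \<sigma> b" "exec c \<sigma> t \<tau>" "t \<le> T" "I (Suc k) \<tau>" unfolding runs_def by blast
  have "runs (While b c) \<tau> ((N - Suc k) * (1 + bcost b + T) + (1 + bcost b)) (I N)"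
    using Suc.hyps k * by simp
  then obtain t' \<tau>' where **: "exec (While b c) \<tau> t' \<tau>'" "I N \<tau>'"
    "t' \<le> (N - Suc k) * (1 + bcost b + T) + (1 + bcost b)" unfolding runs_def by blast
  have "N - k = Suc (N - Suc k)" using k by simp
  then have "1 + bcost b + t + t' \<le> (N - k) * (1 + bcost b + T) + (1 + bcost b)"
    using **(3) *(3) by simp
  with exec.WhileTrue[OF *(1,2) **(1)] **(2) show ?case unfolding runs_def by blast
qed

abbreviation var :: "string \<Rightarrow> nexp" where "var v \<equiv> NCell v []"

text \<open>The bound \<open>e\<close> is evaluated anew before every round, which is why the rule
  below asks the invariant to determine its value.\<close>

definition for_loop :: "string \<Rightarrow> nat \<Rightarrow> nexp \<Rightarrow> com \<Rightarrow> com" where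
  "for_loop v a e c = Seq (NAssign v [] (NLit a))
     (While (NLess (var v) e) (Seq c (NAssign v [] (NAdd (var v) (NLit 1)))))"

text \<open>The body must preserve the counter and establish the next invariant in the state after
  the increment. A round costs \<open>3 + ncost e\<close> for the test and \<open>5 + T\<close> for
  body and increment; the remaining \<open>6 + ncost e\<close> covers initialization, sequencing and
  the final test.\<close>

lemma runs_for_loop:
  assumes "a \<le> b" and init: "I a (nstore v [] a \<sigma>)"
    and step: "\<And>k \<tau>. a \<le> k \<Longrightarrow> k < b \<Longrightarrow> nmem \<tau> v [] = k \<Longrightarrow> I k \<tau> \<Longrightarrow>
      runs c \<tau> T (\<lambda>\<tau>'. nmem \<tau>' v [] = k \<and> I (Suc k) (nstore v [] (Suc k) \<tau>'))"
    and bound: "\<And>k \<tau>. I k \<tau> \<Longrightarrow> nval \<tau> e = b"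
    and time: "(b - a) * (8 + ncost e + T) + (6 + ncost e) \<le> U"
  shows "runs (for_loop v a e c) \<sigma> U (I b)"
proof -
  let ?b = "NLess (var v) e" and ?c = "Seq c (NAssign v [] (NAdd (var v) (NLit 1)))"
  \<comment> \<open>The invariant is strengthened to tie the counter to the index, so that comparing
    the index with \<open>b\<close> decides the loop test.\<close>
  let ?I = "\<lambda>k \<tau>. a \<le> k \<and> nmem \<tau> v [] = k \<and> I k \<tau>"
  have body: "bval \<tau> ?b \<and> runs ?c \<tau> (5 + T) (?I (Suc k))" if k: "k < b" "?I k \<tau>" for k \<tau>
  proof
    from k have k': "a \<le> k" "nmem \<tau> v [] = k" "I k \<tau>" by auto
    show "bval \<tau> ?b" using k'(2) k(1) bound[OF k'(3)] by simp
    show "runs ?c \<tau> (5 + T) (?I (Suc k))"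
      by (rule runs_Seq[OF step[OF k'(1) k(1) k'(2,3)]], rule runs_NAssign[where T = 4])
        (use k' in \<open>auto simp: nstore_def\<close>)
  qed
  have exit: "\<not> bval \<tau> ?b" if "?I b \<tau>" for \<tau>
    using that bound[of b \<tau>] by simp
  have start: "?I a (nstore v [] a \<sigma>)" using init by (simp add: nstore_def)
  have loop: "runs (While ?b ?c) (nstore v [] a \<sigma>)
      ((b - a) * (1 + bcost ?b + (5 + T)) + (1 + bcost ?b)) (?I b)"
    by (rule runs_While[where I = ?I, OF body exit \<open>a \<le> b\<close> start])
  show ?thesis
    unfolding for_loop_def
    by (rule runs_Seq[where Q = "\<lambda>\<tau>. \<tau> = nstore v [] a \<sigma>" and T = 2, OF runs_NAssign],
        simp, simp, hypsubst, rule runs_mono[OF loop order.refl])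
      (use time in \<open>auto simp: algebra_simps\<close>)
qed

lemma nmem_nstore [simp]: "nmem (nstore a is v \<sigma>) = (nmem \<sigma>)(a := (nmem \<sigma> a)(is := v))"
  and rmem_nstore [simp]: "rmem (nstore a is v \<sigma>) = rmem \<sigma>"
  and nmem_rstore [simp]: "nmem (rstore a is w \<sigma>) = nmem \<sigma>"
  and rmem_rstore [simp]: "rmem (rstore a is w \<sigma>) = (rmem \<sigma>)(a := (rmem \<sigma> a)(is := w))"
  by (simp_all add: nstore_def rstore_def)

section \<open>The program\<close>

text \<open>Each power is obtained from the previous one by a single multiplication. The last round
  writes \<open>x[j, d]\<close>, one cell past the output row.\<close>

definition doc_prog :: com where
  "doc_prog = for_loop ''j'' 1 (NAdd (var ''m'') (NLit 1))
     (Seq (RAssign ''x'' [var ''j'', NLit 0] (ROfNat (NLit 1)))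
       (for_loop ''k'' 0 (var ''d'')
         (RAssign ''x'' [var ''j'', NAdd (var ''k'') (NLit 1)]
           (RMul (RCell ''x'' [var ''j'', var ''k'']) (ROfNat (var ''j''))))))"

text \<open>The cell \<open>P[i, l, p]\<close> receives coefficient \<open>p\<close> of $-X^2 \prod_{t<l} (X - S[i,t])^2$;
  all cells with $p < 2$ keep their initial value \<open>0\<close>.\<close>

definition factor_prog :: com where
  "factor_prog = for_loop ''k'' 0 (var ''d'')
     (RAssign ''P'' [var ''i'', NAdd (var ''l'') (NLit 1), NAdd (var ''k'') (NLit 2)]
       (RAdd
         (RSub (RCell ''P'' [var ''i'', var ''l'', var ''k''])
           (RMul (ROfNat (NMul (NLit 2) (NCell ''S'' [var ''i'', var ''l''])))
             (RCell ''P'' [var ''i'', var ''l'', NAdd (var ''k'') (NLit 1)])))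
         (RMul (ROfNat (NMul (NCell ''S'' [var ''i'', var ''l'']) (NCell ''S'' [var ''i'', var ''l''])))
           (RCell ''P'' [var ''i'', var ''l'', NAdd (var ''k'') (NLit 2)]))))"

text \<open>Level \<open>size[i]\<close> holds the full product; the offset 2 undoes the shift by
  X^2.\<close>

definition copy_prog :: com where
  "copy_prog = for_loop ''k'' 0 (var ''d'')
     (RAssign ''q'' [var ''i'', var ''k'']
       (RCell ''P'' [var ''i'', NCell ''size'' [var ''i''], NAdd (var ''k'') (NLit 2)]))"

text \<open>The empty product gives the start polynomial -X^2, hence the entry -1 at position 2. It
  is written as 0 - 1 because all literals are natural numbers.\<close>

definition query_prog :: com where
  "query_prog = for_loop ''i'' 1 (NAdd (var ''n'') (NLit 1))
     (Seq (RAssign ''P'' [var ''i'', NLit 0, NLit 2] (RSub (ROfNat (NLit 0)) (ROfNat (NLit 1))))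
       (Seq (for_loop ''l'' 0 (NCell ''size'' [var ''i'']) factor_prog) copy_prog))"

text \<open>In the \<open>Skip\<close> branch the cell \<open>d\<close> keeps its initial value 0,
  which is then the output dimension.\<close>

definition embed_prog :: com where
  "embed_prog = Cond (NLess (NLit 1) (var ''m''))
     (Seq (NAssign ''d'' [] (NAdd (NMul (NLit 2) (var ''s'')) (NLit 1))) (Seq doc_prog query_prog))
     Skip"

section \<open>Loop invariants and their preservation under single assignments\<close>

context
  fixes n m :: nat and sz :: "nat \<Rightarrow> nat" and S :: "nat \<Rightarrow> nat \<Rightarrow> nat" and d :: nat
begin

text \<open>The natural-number cells that \<open>doc_prog\<close> and \<open>query_prog\<close> read
  but never write.\<close>

definition inputs :: "state \<Rightarrow> bool" where
  "inputs \<sigma> \<longleftrightarrow> nmem \<sigma> ''n'' [] = n \<and> nmem \<sigma> ''m'' [] = m \<and> nmem \<sigma> ''d'' [] = d \<and>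
     (\<forall>i\<in>{1..n}. nmem \<sigma> ''size'' [i] = sz i) \<and>
     (\<forall>i\<in>{1..n}. \<forall>l<sz i. nmem \<sigma> ''S'' [i, l] = S i l)"

lemma inputs_nstore [simp]:
  "v \<in> {''i'', ''j'', ''k'', ''l''} \<Longrightarrow> inputs (nstore v is e \<sigma>) \<longleftrightarrow> inputs \<sigma>"
  by (auto simp: inputs_def)

lemma inputs_rstore [simp]: "inputs (rstore a is w \<sigma>) \<longleftrightarrow> inputs \<sigma>"
  by (auto simp: inputs_def)

definition docs_upto :: "nat \<Rightarrow> state \<Rightarrow> bool" where
  "docs_upto j \<sigma> \<longleftrightarrow> (\<forall>j'\<in>{1..<j}. \<forall>k<d. rmem \<sigma> ''x'' [j', k] = real j' ^ k)"

definition queries_upto :: "nat \<Rightarrow> state \<Rightarrow> bool" where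
  "queries_upto i \<sigma> \<longleftrightarrow>
     (\<forall>i'\<in>{1..<i}. \<forall>k<d. rmem \<sigma> ''q'' [i', k] = coeff (root_poly (S i') (sz i')) k)"

text \<open>Rows of the work array not yet started. The recurrence relies on their zeros at
  positions 0 and 1 and above the current degree.\<close>

definition P_zero_from :: "nat \<Rightarrow> state \<Rightarrow> bool" where
  "P_zero_from i \<sigma> \<longleftrightarrow> (\<forall>i'\<ge>i. \<forall>l p. rmem \<sigma> ''P'' [i', l, p] = 0)"

text \<open>Snapshot of row \<open>i\<close> after \<open>k\<close> rounds of the inner loop: levels
  up to \<open>l\<close> are complete, level \<open>l + 1\<close> is correct below position
  \<open>k + 2\<close>, and all other cells are still 0.\<close>

definition filled :: "nat \<Rightarrow> nat \<Rightarrow> nat \<Rightarrow> state \<Rightarrow> bool" where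
  "filled i l k \<sigma> \<longleftrightarrow> (\<forall>l' p. rmem \<sigma> ''P'' [i, l', p] =
     (if l' \<le> l \<or> l' = Suc l \<and> p < k + 2 then shifted_coeff (S i) l' p else 0))"

lemma frame_simps [simp]:
  "docs_upto j (nstore a is v \<sigma>) \<longleftrightarrow> docs_upto j \<sigma>"
  "queries_upto i (nstore a is v \<sigma>) \<longleftrightarrow> queries_upto i \<sigma>"
  "P_zero_from i (nstore a is v \<sigma>) \<longleftrightarrow> P_zero_from i \<sigma>"
  "filled i l k (nstore a is v \<sigma>) \<longleftrightarrow> filled i l k \<sigma>"
  "a \<noteq> ''x'' \<Longrightarrow> docs_upto j (rstore a is w \<sigma>) \<longleftrightarrow> docs_upto j \<sigma>"
  "a \<noteq> ''q'' \<Longrightarrow> queries_upto i (rstore a is w \<sigma>) \<longleftrightarrow> queries_upto i \<sigma>"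
  "a \<noteq> ''P'' \<Longrightarrow> P_zero_from i (rstore a is w \<sigma>) \<longleftrightarrow> P_zero_from i \<sigma>"
  "a \<noteq> ''P'' \<Longrightarrow> filled i l k (rstore a is w \<sigma>) \<longleftrightarrow> filled i l k \<sigma>"
  by (simp_all add: docs_upto_def queries_upto_def P_zero_from_def filled_def)

text \<open>The bound is exclusive, so a write to the row under construction does not disturb the
  finished ones.\<close>

lemma docs_upto_rstore: "docs_upto j \<sigma> \<Longrightarrow> docs_upto j (rstore ''x'' [j, k] w \<sigma>)"
  by (simp add: docs_upto_def)

lemma docs_upto_Suc:
  "docs_upto j \<sigma> \<Longrightarrow> \<forall>k\<le>d. rmem \<sigma> ''x'' [j, k] = real j ^ k \<Longrightarrow> docs_upto (Suc j) \<sigma>"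
  by (auto simp: docs_upto_def less_Suc_eq)

lemma queries_upto_rstore: "queries_upto i \<sigma> \<Longrightarrow> queries_upto i (rstore ''q'' [i, k] w \<sigma>)"
  by (simp add: queries_upto_def)

lemma queries_upto_Suc:
  "queries_upto i \<sigma> \<Longrightarrow> \<forall>k<d. rmem \<sigma> ''q'' [i, k] = coeff (root_poly (S i) (sz i)) k \<Longrightarrow>
    queries_upto (Suc i) \<sigma>"
  by (auto simp: queries_upto_def less_Suc_eq)

lemma P_zero_from_rstore:
  "P_zero_from (Suc i) \<sigma> \<Longrightarrow> P_zero_from (Suc i) (rstore ''P'' [i, l, p] w \<sigma>)"
  by (simp add: P_zero_from_def)

lemma P_zero_from_Suc: "P_zero_from i \<sigma> \<Longrightarrow> P_zero_from (Suc i) \<sigma>"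
  by (simp add: P_zero_from_def)

text \<open>The completed inner loop reached the positions below \<open>d + 2\<close>. Beyond them
  both the cells and the coefficients vanish, the latter by the degree bound. At
  \<open>k = 0\<close> the next level claims only positions 0 and 1, where zero is correct.\<close>

lemma filled_Suc:
  assumes "2 * Suc l < d" "filled i l d \<sigma>"
  shows "filled i (Suc l) 0 \<sigma>"
proof -
  have "shifted_coeff (S i) (Suc l) p = 0" if "\<not> p < d + 2" for p
    using that assms(1) by (intro shifted_coeff_high) simp
  then show ?thesis
    using assms(2) unfolding filled_def by (auto simp: shifted_coeff_low le_Suc_eq)
qed

text \<open>All three cells read lie in the complete level \<open>l\<close>, while the write goes to
  level \<open>l + 1\<close>; the stored value is therefore the one given by
  \<open>shifted_coeff_Suc\<close>.\<close>

lemma filled_step: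
  assumes "filled i l k \<sigma>"
  shows "filled i l (Suc k) (rstore ''P'' [i, Suc l, k + 2]
    (rmem \<sigma> ''P'' [i, l, k] - real (2 * S i l) * rmem \<sigma> ''P'' [i, l, k + 1]
      + real (S i l * S i l) * rmem \<sigma> ''P'' [i, l, k + 2]) \<sigma>)" (is "filled i l (Suc k) (rstore _ _ ?w _)")
proof -
  have P: "rmem \<sigma> ''P'' [i, l', p] =
      (if l' \<le> l \<or> l' = Suc l \<and> p < k + 2 then shifted_coeff (S i) l' p else 0)" for l' p
    using assms unfolding filled_def by blast
  have "?w = shifted_coeff (S i) (Suc l) (k + 2)"
    by (simp add: P shifted_coeff_Suc power2_eq_square)
  then show ?thesis
    unfolding filled_def rmem_rstore by (auto simp: P)
qed

lemma filled_0:
  assumes "P_zero_from i \<sigma>"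
  shows "filled i 0 0 (rstore ''P'' [i, 0, 2] (- 1) \<sigma>)"
proof -
  have "rmem \<sigma> ''P'' [i, l, p] = 0" for l p using assms by (simp add: P_zero_from_def)
  then show ?thesis
    unfolding filled_def rmem_rstore by (auto simp: shifted_coeff_0 shifted_coeff_low)
qed

definition query_inv :: "nat \<Rightarrow> state \<Rightarrow> bool" where
  "query_inv i \<sigma> \<longleftrightarrow> inputs \<sigma> \<and> docs_upto (m + 1) \<sigma> \<and> queries_upto i \<sigma> \<and> P_zero_from i \<sigma>"

text \<open>Row \<open>i\<close> of \<open>P\<close> is in use here and described by
  \<open>filled\<close>, so only the rows from \<open>Suc i\<close> on are required to be
  zero.\<close>

definition fill_inv :: "nat \<Rightarrow> nat \<Rightarrow> nat \<Rightarrow> state \<Rightarrow> bool" where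
  "fill_inv i l k \<sigma> \<longleftrightarrow> inputs \<sigma> \<and> docs_upto (m + 1) \<sigma> \<and> queries_upto i \<sigma> \<and>
     P_zero_from (Suc i) \<sigma> \<and> nmem \<sigma> ''i'' [] = i \<and> filled i l k \<sigma>"

lemma fill_inv_nstore:
  "v \<in> {''k'', ''l''} \<Longrightarrow> fill_inv i l k (nstore v is e \<sigma>) \<longleftrightarrow> fill_inv i l k \<sigma>"
  by (auto simp: fill_inv_def)

section \<open>Running the loops, with explicit costs\<close>

lemma runs_doc_prog:
  assumes "inputs \<sigma>" "P_zero_from 1 \<sigma>"
  shows "runs doc_prog \<sigma> (m * (33 + d * 20) + 9)
    (\<lambda>\<tau>. inputs \<tau> \<and> P_zero_from 1 \<tau> \<and> docs_upto (m + 1) \<tau>)"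
proof -
  define I where "I j \<tau> \<longleftrightarrow> inputs \<tau> \<and> P_zero_from 1 \<tau> \<and> docs_upto j \<tau>" for j \<tau>
  \<comment> \<open>The entry at \<open>k\<close> itself is included, because the next power is
    computed from it.\<close>
  define J where "J j k \<tau> \<longleftrightarrow> I j \<tau> \<and> nmem \<tau> ''j'' [] = j \<and>
    (\<forall>k'\<le>k. rmem \<tau> ''x'' [j, k'] = real j ^ k')" for j k \<tau>
  have inner: "runs (for_loop ''k'' 0 (var ''d'')
         (RAssign ''x'' [var ''j'', NAdd (var ''k'') (NLit 1)]
           (RMul (RCell ''x'' [var ''j'', var ''k'']) (ROfNat (var ''j''))))) \<tau> (d * 20 + 7) (J j d)"
    if "J j 0 \<tau>" for j \<tau>
  proof (rule runs_for_loop[where b = d and I = "J j" and T = 11])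
    fix k \<tau> assume *: "nmem \<tau> ''k'' [] = k" "J j k \<tau>"
    show "runs (RAssign ''x'' [var ''j'', NAdd (var ''k'') (NLit 1)]
           (RMul (RCell ''x'' [var ''j'', var ''k'']) (ROfNat (var ''j'')))) \<tau> 11
        (\<lambda>\<tau>'. nmem \<tau>' ''k'' [] = k \<and> J j (Suc k) (nstore ''k'' [] (Suc k) \<tau>'))"
      by (rule runs_RAssign)
        (use * in \<open>auto simp: J_def I_def docs_upto_rstore le_Suc_eq\<close>)
  next
    show "nval \<tau> (var ''d'') = d" if "J j k \<tau>" for k \<tau>
      using that by (simp add: J_def I_def inputs_def)
  qed (use that in \<open>auto simp: J_def I_def\<close>)
  have "runs doc_prog \<sigma> (m * (33 + d * 20) + 9) (I (m + 1))"
    unfolding doc_prog_def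
  proof (rule runs_for_loop[where T = "d * 20 + 14"])
    fix j \<tau> assume *: "nmem \<tau> ''j'' [] = j" "I j \<tau>" and "1 \<le> j"
    have J0: "J j 0 (rstore ''x'' (map (nval \<tau>) [var ''j'', NLit 0]) (rval \<tau> (ROfNat (NLit 1))) \<tau>)"
      using * by (auto simp: J_def I_def docs_upto_rstore)
    have "I (Suc j) (nstore ''j'' [] (Suc j) \<tau>')" if "J j d \<tau>'" for \<tau>'
      using that docs_upto_Suc by (simp add: J_def I_def)
    then have final: "nmem \<tau>' ''j'' [] = j \<and> I (Suc j) (nstore ''j'' [] (Suc j) \<tau>')" if "J j d \<tau>'" for \<tau>'
      using that by (auto simp: J_def)
    show "runs (Seq (RAssign ''x'' [var ''j'', NLit 0] (ROfNat (NLit 1)))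
       (for_loop ''k'' 0 (var ''d'')
         (RAssign ''x'' [var ''j'', NAdd (var ''k'') (NLit 1)]
           (RMul (RCell ''x'' [var ''j'', var ''k'']) (ROfNat (var ''j'')))))) \<tau> (d * 20 + 14)
      (\<lambda>\<tau>'. nmem \<tau>' ''j'' [] = j \<and> I (Suc j) (nstore ''j'' [] (Suc j) \<tau>'))"
      by (rule runs_Seq[OF runs_RAssign[where Q = "J j 0" and T = 6, OF J0]
            runs_mono[OF inner order.refl final]]) auto
  next
    show "nval \<tau> (NAdd (var ''m'') (NLit 1)) = m + 1" if "I j \<tau>" for j \<tau>
      using that by (simp add: I_def inputs_def)
  next
    show "I 1 (nstore ''j'' [] 1 \<sigma>)" using assms by (simp add: I_def docs_upto_def)
  qed (auto simp: algebra_simps)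
  then show ?thesis unfolding I_def .
qed

lemma runs_factor_prog:
  assumes "i \<in> {1..n}" "l < sz i" "fill_inv i l 0 \<sigma>" "nmem \<sigma> ''l'' [] = l"
  shows "runs factor_prog \<sigma> (d * 51 + 7) (\<lambda>\<tau>. fill_inv i l d \<tau> \<and> nmem \<tau> ''l'' [] = l)"
  unfolding factor_prog_def
\<comment> \<open>The assignment costs 42 units; the loop overhead of 9 per round makes 51.\<close>
proof (rule runs_for_loop[where b = d and T = 42 and
      I = "\<lambda>k \<tau>. fill_inv i l k \<tau> \<and> nmem \<tau> ''l'' [] = l"])
  fix k \<tau> assume k: "nmem \<tau> ''k'' [] = k" and *: "fill_inv i l k \<tau> \<and> nmem \<tau> ''l'' [] = l"
  let ?w = "rmem \<tau> ''P'' [i, l, k] - real (2 * S i l) * rmem \<tau> ''P'' [i, l, k + 1]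
      + real (S i l * S i l) * rmem \<tau> ''P'' [i, l, k + 2]"
  have vals: "nmem \<tau> ''i'' [] = i" "nmem \<tau> ''l'' [] = l" "nmem \<tau> ''S'' [i, l] = S i l"
    using * assms(1,2) by (auto simp: fill_inv_def inputs_def)
  have "fill_inv i l (Suc k) (rstore ''P'' [i, Suc l, k + 2] ?w \<tau>)"
    using * filled_step[of i l k \<tau>] unfolding fill_inv_def by (simp add: P_zero_from_rstore)
  then show "runs (RAssign ''P'' [var ''i'', NAdd (var ''l'') (NLit 1), NAdd (var ''k'') (NLit 2)]
       (RAdd
         (RSub (RCell ''P'' [var ''i'', var ''l'', var ''k''])
           (RMul (ROfNat (NMul (NLit 2) (NCell ''S'' [var ''i'', var ''l''])))
             (RCell ''P'' [var ''i'', var ''l'', NAdd (var ''k'') (NLit 1)])))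
         (RMul (ROfNat (NMul (NCell ''S'' [var ''i'', var ''l'']) (NCell ''S'' [var ''i'', var ''l''])))
           (RCell ''P'' [var ''i'', var ''l'', NAdd (var ''k'') (NLit 2)])))) \<tau> 42
      (\<lambda>\<tau>'. nmem \<tau>' ''k'' [] = k \<and> fill_inv i l (Suc k) (nstore ''k'' [] (Suc k) \<tau>') \<and>
        nmem (nstore ''k'' [] (Suc k) \<tau>') ''l'' [] = l)"
    by (intro runs_RAssign) (simp_all add: vals k fill_inv_nstore)
next
  show "nval \<tau> (var ''d'') = d" if "fill_inv i l k \<tau> \<and> nmem \<tau> ''l'' [] = l" for k \<tau>
    using that by (simp add: fill_inv_def inputs_def)
qed (use assms in \<open>auto simp: fill_inv_nstore\<close>)

context
  fixes s :: nat
  assumes size_le: "\<And>i. i \<in> {1..n} \<Longrightarrow> sz i \<le> s" and s_less: "2 * s < d"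
begin

lemma runs_factors:
  assumes "i \<in> {1..n}" "fill_inv i 0 0 \<sigma>"
  shows "runs (for_loop ''l'' 0 (NCell ''size'' [var ''i'']) factor_prog) \<sigma>
    (s * (d * 51 + 17) + 8) (fill_inv i (sz i) 0)"
proof (rule runs_for_loop[where b = "sz i" and T = "d * 51 + 7" and I = "\<lambda>l. fill_inv i l 0"])
  fix l \<tau> assume l: "nmem \<tau> ''l'' [] = l" "fill_inv i l 0 \<tau>" "l < sz i"
  have "Suc l \<le> s" using l(3) size_le[OF assms(1)] by linarith
  \<comment> \<open>Every intermediate product, not only the last, has its coefficients within the
    range of the inner loop, as \<open>filled_Suc\<close> requires.\<close>
  then have "2 * Suc l < d" using s_less by simp
  then have next_level: "fill_inv i (Suc l) 0 (nstore ''l'' [] (Suc l) \<tau>')" if "fill_inv i l d \<tau>'" for \<tau>'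
    using that filled_Suc by (simp add: fill_inv_nstore) (simp add: fill_inv_def)
  show "runs factor_prog \<tau> (d * 51 + 7)
      (\<lambda>\<tau>'. nmem \<tau>' ''l'' [] = l \<and> fill_inv i (Suc l) 0 (nstore ''l'' [] (Suc l) \<tau>'))"
    by (rule runs_mono[OF runs_factor_prog[OF assms(1) l(3,2,1)] order.refl]) (simp add: next_level)
next
  have "(sz i - 0) * (8 + ncost (NCell ''size'' [var ''i'']) + (d * 51 + 7)) \<le> s * (d * 51 + 17)"
    using size_le[OF assms(1)] by (intro mult_mono) auto
  then show "(sz i - 0) * (8 + ncost (NCell ''size'' [var ''i'']) + (d * 51 + 7))
    + (6 + ncost (NCell ''size'' [var ''i''])) \<le> s * (d * 51 + 17) + 8" by simp
next
  show "nval \<tau> (NCell ''size'' [var ''i'']) = sz i" if "fill_inv i l 0 \<tau>" for l \<tau>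
    using that assms(1) by (simp add: fill_inv_def inputs_def)
qed (use assms in \<open>auto simp: fill_inv_nstore\<close>)

text \<open>Copying turns the finished level into the output row. Forgetting row \<open>i\<close> of
  \<open>P\<close> then leaves exactly the outer invariant for the next query.\<close>

lemma runs_copy_prog:
  assumes "i \<in> {1..n}" "fill_inv i (sz i) 0 \<sigma>"
  shows "runs copy_prog \<sigma> (d * 19 + 7)
    (\<lambda>\<tau>. nmem \<tau> ''i'' [] = i \<and> query_inv (Suc i) (nstore ''i'' [] (Suc i) \<tau>))"
proof -
  define J where "J k \<tau> \<longleftrightarrow> fill_inv i (sz i) 0 \<tau> \<and>
    (\<forall>k'<k. rmem \<tau> ''q'' [i, k'] = coeff (root_poly (S i) (sz i)) k')" for k \<tau>
  have J0: "J 0 (nstore ''k'' [] 0 \<sigma>)" using assms(2) by (simp add: J_def fill_inv_nstore)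
  have bound: "nval \<tau> (var ''d'') = d" if "J k \<tau>" for k \<tau>
    using that by (simp add: J_def fill_inv_def inputs_def)
  have "runs copy_prog \<sigma> (d * 19 + 7) (J d)"
    unfolding copy_prog_def
  proof (rule runs_for_loop[where b = d and T = 10 and I = J, OF _ J0 _ bound])
    fix k \<tau> assume k: "nmem \<tau> ''k'' [] = k" and J: "J k \<tau>"
    have vals: "nmem \<tau> ''i'' [] = i" "nmem \<tau> ''size'' [i] = sz i"
      "rmem \<tau> ''P'' [i, sz i, Suc (Suc k)] = coeff (root_poly (S i) (sz i)) k"
      using J assms(1) by (auto simp: J_def fill_inv_def inputs_def filled_def shifted_coeff_add2)
    have "J (Suc k) (rstore ''q'' [i, k] (coeff (root_poly (S i) (sz i)) k) \<tau>)"
      using J unfolding J_def fill_inv_def by (simp add: queries_upto_rstore less_Suc_eq)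
    then have "J (Suc k) (nstore ''k'' [] (Suc k)
        (rstore ''q'' [i, k] (coeff (root_poly (S i) (sz i)) k) \<tau>))"
      by (simp add: J_def fill_inv_nstore)
    then show "runs (RAssign ''q'' [var ''i'', var ''k'']
       (RCell ''P'' [var ''i'', NCell ''size'' [var ''i''], NAdd (var ''k'') (NLit 2)])) \<tau> 10
      (\<lambda>\<tau>'. nmem \<tau>' ''k'' [] = k \<and> J (Suc k) (nstore ''k'' [] (Suc k) \<tau>'))"
      by (intro runs_RAssign) (simp_all add: vals k)
  qed auto
  then show ?thesis
    by (rule runs_mono) (simp_all add: J_def fill_inv_def query_inv_def queries_upto_Suc)
qed

lemma runs_query_prog:
  assumes "inputs \<sigma>" "docs_upto (m + 1) \<sigma>" "P_zero_from 1 \<sigma>"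
  shows "runs query_prog \<sigma> (n * (s * (d * 51 + 17) + d * 19 + 37) + 9) (query_inv (n + 1))"
  unfolding query_prog_def
proof (rule runs_for_loop[where b = "n + 1" and T = "s * (d * 51 + 17) + d * 19 + 26"
      and I = query_inv])
  fix i \<tau> assume i: "1 \<le> i" "i < n + 1" "nmem \<tau> ''i'' [] = i" "query_inv i \<tau>"
  then have "i \<in> {1..n}" by simp
  have "fill_inv i 0 0 (rstore ''P'' [i, 0, 2] (- 1) \<tau>)"
    using i filled_0[of i \<tau>] P_zero_from_Suc
    unfolding fill_inv_def query_inv_def by (simp add: P_zero_from_rstore)
  then have "fill_inv i 0 0 (rstore ''P'' (map (nval \<tau>) [var ''i'', NLit 0, NLit 2])
      (rval \<tau> (RSub (ROfNat (NLit 0)) (ROfNat (NLit 1)))) \<tau>)"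
    using i(3) by simp
  note first = runs_RAssign[where T = 9 and Q = "fill_inv i 0 0", OF this]
  show "runs (Seq (RAssign ''P'' [var ''i'', NLit 0, NLit 2] (RSub (ROfNat (NLit 0)) (ROfNat (NLit 1))))
       (Seq (for_loop ''l'' 0 (NCell ''size'' [var ''i'']) factor_prog) copy_prog)) \<tau>
     (s * (d * 51 + 17) + d * 19 + 26)
     (\<lambda>\<tau>'. nmem \<tau>' ''i'' [] = i \<and> query_inv (Suc i) (nstore ''i'' [] (Suc i) \<tau>'))"
    by (rule runs_Seq[OF first runs_Seq[OF runs_factors[OF \<open>i \<in> {1..n}\<close>]
            runs_copy_prog[OF \<open>i \<in> {1..n}\<close>] order.refl]]) simp_all
next
  show "query_inv 1 (nstore ''i'' [] 1 \<sigma>)"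
    using assms by (simp add: query_inv_def queries_upto_def)
next
  show "nval \<tau> (NAdd (var ''n'') (NLit 1)) = n + 1" if "query_inv i \<tau>" for i \<tau>
    using that by (simp add: query_inv_def inputs_def)
qed (simp_all add: add_mult_distrib2)

end

end

section \<open>Correctness and running time\<close>

lemma scalar_prod_output:
  assumes "docs_upto d (m + 1) \<tau>" "queries_upto sz S d (n + 1) \<tau>" "output_dim \<tau> = d"
    and "2 * sz i < d" "i \<in> {1..n}" "j \<in> {1..m}"
  shows "scalar_prod (output_query \<tau> i) (output_doc \<tau> j)
    = - (\<Prod>t<sz i. (real j - real (S i t))\<^sup>2)"
proof -
  have "scalar_prod (output_query \<tau> i) (output_doc \<tau> j)
      = (\<Sum>k<d. coeff (root_poly (S i) (sz i)) k * real j ^ k)"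
    using assms by (simp add: scalar_prod_def output_query_def output_doc_def
        docs_upto_def queries_upto_def atLeast0LessThan less_Suc_eq_le)
  then show ?thesis using sum_coeff_root_poly[OF assms(4)] by simp
qed

lemma runs_embed_prog:
  fixes R :: "nat \<Rightarrow> nat set"
  assumes "1 < m" "\<And>i. i \<in> {1..n} \<Longrightarrow> card (R i) \<le> s"
    and finite: "\<And>i. i \<in> {1..n} \<Longrightarrow> finite (R i)" and "\<epsilon> < 1 / 2" and d: "d = 2 * s + 1"
  shows "runs embed_prog (initial_state n m R \<epsilon> s \<omega>)
    (m * (33 + d * 20) + n * (s * (d * 51 + 17) + d * 19 + 37) + 31)
    (\<lambda>\<tau>. output_dim \<tau> = d \<and>
      separating_embedding n m R \<epsilon> d (- 1 / 2) (output_query \<tau>) (output_doc \<tau>))"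
proof -
  define sz where "sz i = card (R i)" for i
  define S where "S i l = sorted_list_of_set (R i) ! l" for i l
  have size_le: "sz i \<le> s" if "i \<in> {1..n}" for i using assms(2)[OF that] by (simp add: sz_def)
  have "2 * s < d" using d by simp
  let ?\<sigma> = "initial_state n m R \<epsilon> s \<omega>"
  let ?\<sigma>' = "nstore ''d'' (map (nval ?\<sigma>) []) (nval ?\<sigma> (NAdd (NMul (NLit 2) (var ''s'')) (NLit 1))) ?\<sigma>"
  have inputs: "inputs n m sz S d ?\<sigma>'"
    using d by (auto simp: inputs_def initial_state_def sz_def S_def)
  have P0: "P_zero_from 1 ?\<sigma>'" by (simp add: P_zero_from_def initial_state_def)
  \<comment> \<open>The array lists the relevant set exactly: one inclusion makes each relevant
    document a root, the other keeps irrelevant documents away from the roots.\<close>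
  have set_R: "R i = S i ` {..<sz i}" if "i \<in> {1..n}" for i
  proof -
    have "R i = set (sorted_list_of_set (R i))" using finite[OF that] by simp
    also have "\<dots> = S i ` {..<sz i}"
      by (auto simp: set_conv_nth S_def sz_def)
    finally show ?thesis .
  qed
  have correct: "output_dim \<tau> = d \<and>
      separating_embedding n m R \<epsilon> d (- 1 / 2) (output_query \<tau>) (output_doc \<tau>)"
    if \<tau>: "query_inv n m sz S d (n + 1) \<tau>" for \<tau>
  proof -
    from \<tau> have inv: "docs_upto d (m + 1) \<tau>" "queries_upto sz S d (n + 1) \<tau>"
      and dim: "output_dim \<tau> = d"
      by (auto simp: query_inv_def inputs_def output_dim_def)
    have "(j \<in> R i \<longrightarrow> scalar_prod (output_query \<tau> i) (output_doc \<tau> j) \<ge> - 1 / 2 + \<epsilon>) \<and>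
        (j \<notin> R i \<longrightarrow> scalar_prod (output_query \<tau> i) (output_doc \<tau> j) \<le> - 1 / 2 - \<epsilon>)"
      if ij: "i \<in> {1..n}" "j \<in> {1..m}" for i j
    proof -
      have "2 * sz i < d" using size_le[OF ij(1)] \<open>2 * s < d\<close> by linarith
      note eq = scalar_prod_output[OF inv dim this ij]
      show ?thesis
      proof (cases "j \<in> R i")
        case True
        then obtain t where "t < sz i" "j = S i t" using set_R[OF ij(1)] by auto
        \<comment> \<open>The scores are 0 here and at most -1 in the other case, so -1/2 separates
          them with any margin below 1/2.\<close>
        then have "scalar_prod (output_query \<tau> i) (output_doc \<tau> j) = 0"
          unfolding eq by (simp only: root_poly_zero)
        with True \<open>\<epsilon> < 1 / 2\<close> show ?thesis by simp
      next
        case False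
        then have "S i t \<noteq> j" if "t < sz i" for t using that set_R[OF ij(1)] by auto
        then have "scalar_prod (output_query \<tau> i) (output_doc \<tau> j) \<le> - 1"
          unfolding eq by (rule root_poly_le_minus_1)
        with False \<open>\<epsilon> < 1 / 2\<close> show ?thesis by simp
      qed
    qed
    then show ?thesis
      using dim by (simp add: separating_embedding_def output_query_def output_doc_def)
  qed
  let ?Td = "m * (33 + d * 20) + 9" and ?Tq = "n * (s * (d * 51 + 17) + d * 19 + 37) + 9"
  have main: "runs (Seq doc_prog query_prog) ?\<sigma>' (1 + ?Td + ?Tq) (query_inv n m sz S d (n + 1))"
    by (rule runs_Seq[OF runs_doc_prog[OF inputs P0] runs_query_prog order.refl])
      (use size_le \<open>2 * s < d\<close> in auto)
  have "runs (Seq (NAssign ''d'' [] (NAdd (NMul (NLit 2) (var ''s'')) (NLit 1)))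
      (Seq doc_prog query_prog)) ?\<sigma> (1 + 6 + (1 + ?Td + ?Tq)) (query_inv n m sz S d (n + 1))"
    by (rule runs_Seq[OF runs_NAssign[where T = 6 and Q = "\<lambda>\<tau>. \<tau> = ?\<sigma>'", OF refl]])
      (use main in auto)
  then obtain t \<tau> where *: "exec (Seq (NAssign ''d'' [] (NAdd (NMul (NLit 2) (var ''s'')) (NLit 1)))
      (Seq doc_prog query_prog)) ?\<sigma> t \<tau>" "t \<le> 1 + 6 + (1 + ?Td + ?Tq)"
      "query_inv n m sz S d (n + 1) \<tau>" by (auto simp: runs_def)
  have "bval ?\<sigma> (NLess (NLit 1) (var ''m''))" using \<open>1 < m\<close> by (simp add: initial_state_def)
  from exec.CondTrue[OF this *(1)] correct[OF *(3)] *(2) show ?thesis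
    unfolding runs_def embed_prog_def by (intro exI conjI) auto
qed

text \<open>In dimension 0 every inner product is 0, which exceeds -1/2 + \<epsilon>; by assumption
  there is no irrelevant document to separate.\<close>

lemma runs_embed_prog_trivial:
  assumes "m \<le> 1" "\<And>i. i \<in> {1..n} \<Longrightarrow> {1..m} \<subseteq> R i" "\<epsilon> < 1 / 2"
  shows "runs embed_prog (initial_state n m R \<epsilon> s \<omega>) 5
    (\<lambda>\<tau>. output_dim \<tau> = 0 \<and>
      separating_embedding n m R \<epsilon> 0 (- 1 / 2) (output_query \<tau>) (output_doc \<tau>))"
proof -
  let ?\<sigma> = "initial_state n m R \<epsilon> s \<omega>"
  have "\<not> bval ?\<sigma> (NLess (NLit 1) (var ''m''))" using \<open>m \<le> 1\<close> by (simp add: initial_state_def)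
  from exec.CondFalse[OF this exec.Skip]
  have "exec embed_prog ?\<sigma> (1 + bcost (NLess (NLit 1) (var ''m'')) + 1) ?\<sigma>"
    unfolding embed_prog_def .
  moreover have "1 + bcost (NLess (NLit 1) (var ''m'')) + 1 \<le> 5" by simp
  moreover have dim: "output_dim ?\<sigma> = 0" by (simp add: output_dim_def initial_state_def)
  moreover have "separating_embedding n m R \<epsilon> 0 (- 1 / 2) (output_query ?\<sigma>) (output_doc ?\<sigma>)"
  proof -
    have "j \<in> R i" if "i \<in> {1..n}" "j \<in> {1..m}" for i j using assms(2) that by blast
    then show ?thesis
      using \<open>\<epsilon> < 1 / 2\<close>
      unfolding separating_embedding_def output_query_def output_doc_def dim
      by (simp add: scalar_prod_def)
  qed
  ultimately show ?thesis unfolding runs_def by blast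
qed

section \<open>Absorbing cost and dimension into the stated bounds\<close>

lemma time_bound:
  fixes m n s d :: nat
  assumes "1 < m" "0 < d" "0 < n \<Longrightarrow> 0 < s"
  shows "real (m * (33 + d * 20) + n * (s * (d * 51 + 17) + d * 19 + 37) + 31)
    \<le> soft_bound 124 0 (real m * real d + real n * real s * real d)"
proof -
  have md: "m \<le> m * d" "1 \<le> m * d" using assms(1,2) by auto
  \<comment> \<open>The terms \<open>n * d\<close> and \<open>n\<close> are absorbed because
    \<open>s\<close> is positive as soon as there is a query.\<close>
  have nsd: "n * s \<le> n * s * d" "n * d \<le> n * s * d" "n \<le> n * s * d"
    using assms(2,3) by (cases "n = 0"; simp)+
  \<comment> \<open>Treating the products as atoms makes this linear. The coefficients charged to
    \<open>nsd\<close> add up to 51 + 17 + 19 + 37 = 124, those charged to \<open>md\<close> only to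
    84.\<close>
  have linear: "33 * m + 20 * md + 51 * nsd + 17 * ns + 19 * nd + 37 * n + 31 \<le> 124 * (md + nsd)"
    if "m \<le> md" "1 \<le> md" "ns \<le> nsd" "nd \<le> nsd" "n \<le> nsd" for md nsd ns nd :: nat
  proof -
    have "33 * m + 20 * md + 51 * nsd + 17 * ns + 19 * nd + 37 * n + 31
        \<le> 33 * md + 20 * md + 51 * nsd + 17 * nsd + 19 * nsd + 37 * nsd + 31 * md"
      using that by (intro add_mono mult_le_mono2) simp_all
    also have "\<dots> \<le> 124 * (md + nsd)" by simp
    finally show ?thesis .
  qed
  have "m * (33 + d * 20) + n * (s * (d * 51 + 17) + d * 19 + 37) + 31
      = 33 * m + 20 * (m * d) + 51 * (n * s * d) + 17 * (n * s) + 19 * (n * d) + 37 * n + 31"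
    by (simp add: algebra_simps)
  also have "\<dots> \<le> 124 * (m * d + n * s * d)" by (rule linear[OF md nsd])
  finally have "m * (33 + d * 20) + n * (s * (d * 51 + 17) + d * 19 + 37) + 31
      \<le> 124 * (m * d + n * s * d)" .
  then have "real (m * (33 + d * 20) + n * (s * (d * 51 + 17) + d * 19 + 37) + 31)
      \<le> real (124 * (m * d + n * s * d))" by (rule of_nat_mono)
  also have "\<dots> = 124 * (real m * real d + real n * real s * real d)" by simp
  also have "\<dots> \<le> soft_bound 124 0 (real m * real d + real n * real s * real d)"
    unfolding soft_bound_def power_0 mult_1_right by (intro mult_left_mono) simp_all
  finally show ?thesis .
qed

text \<open>From \<open>m > 1\<close> follows ln m >= 2/3, and 1/\<epsilon>\<open>^2\<close> >= 1,
  so the maximum M satisfies 2s <= 3M and 1 <= (3/2)M. Their sum stays below 5M.\<close>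

lemma dim_bound:
  fixes m s :: nat and \<epsilon> :: real
  assumes "1 < m" "0 < \<epsilon>" "\<epsilon> < 1 / 2"
  shows "real (2 * s + 1) \<le> 5 * max (real s * ln (real m)) (1 / \<epsilon>\<^sup>2 * ln (real m))"
proof -
  let ?L = "ln (real m)"
  have "2 / 3 \<le> ln (2 :: real)" using ln2_ge_two_thirds by simp
  also have "\<dots> \<le> ?L" using \<open>1 < m\<close> by simp
  finally have L: "2 / 3 \<le> ?L" .
  have "real s * (2 / 3) \<le> real s * ?L" using L by (intro mult_left_mono) auto
  moreover have "\<epsilon>\<^sup>2 \<le> (1 / 2)\<^sup>2" using assms by (intro power_mono) auto
  then have "1 \<le> 1 / \<epsilon>\<^sup>2" using assms by (simp add: field_simps power2_eq_square)
  then have "1 * (2 / 3) \<le> 1 / \<epsilon>\<^sup>2 * ?L" using L by (intro mult_mono) auto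
  ultimately show ?thesis by simp
qed

lemma prob_space_gaussian_tape: "prob_space gaussian_tape"
  unfolding gaussian_tape_def
  by (intro prob_space_PiM prob_space_normal_density) simp

text \<open>The constant 5 comes from \<open>dim_bound\<close>; 124 and the logarithmic exponent 0
  come from \<open>time_bound\<close>. The threshold is -1/2, and success on every tape covers the
  exponent \<open>a = 1\<close>.\<close>

theorem theorem3p1:
  shows "\<exists>C::real. C > 0 \<and>
    (\<exists>(prog::com) (K::real) (k::nat) (a::nat). a \<ge> 1 \<and>
      (\<forall>(n::nat) (m::nat) (G::(nat \<times> nat) set) (E::nat \<Rightarrow> nat) (\<epsilon>::real) (s::nat).
        hierarchical_retrieval n m G E \<longrightarrow>
        0 < \<epsilon> \<longrightarrow> \<epsilon> < 1 / 2 \<longrightarrow>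
        (\<forall>i\<in>{1..n}. card (relevant m G E i) \<le> s) \<longrightarrow>
        (\<exists>(d::nat) (r::real).
          real d \<le> C * max (real s * ln (real m)) (1 / \<epsilon>\<^sup>2 * ln (real m)) \<and>
          (\<exists>q x. separating_embedding n m (relevant m G E) \<epsilon> d r q x) \<and>
          (\<forall>\<omega>. \<exists>t \<sigma>. exec prog (initial_state n m (relevant m G E) \<epsilon> s \<omega>) t \<sigma> \<and>
             real t \<le> soft_bound K k (real m * real d + real n * real s * real d)) \<and>
          measure gaussian_tape
            {\<omega> \<in> space gaussian_tape. \<exists>t \<sigma>.
               exec prog (initial_state n m (relevant m G E) \<epsilon> s \<omega>) t \<sigma> \<and>
               output_dim \<sigma> = d \<and>
               separating_embedding n m (relevant m G E) \<epsilon> d r (output_query \<sigma>) (output_doc \<sigma>)}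
            \<ge> 1 - 1 / real m ^ a)))"
proof (rule exI[of _ 5], rule conjI, simp, rule exI[of _ embed_prog], rule exI[of _ 124],
    rule exI[of _ 0], rule exI[of _ 1], rule conjI, simp, intro allI impI)
  fix n m :: nat and G :: "(nat \<times> nat) set" and E :: "nat \<Rightarrow> nat" and \<epsilon> :: real and s :: nat
  assume HR: "hierarchical_retrieval n m G E" and \<epsilon>: "0 < \<epsilon>" "\<epsilon> < 1 / 2"
    and card: "\<forall>i\<in>{1..n}. card (relevant m G E i) \<le> s"
  let ?R = "relevant m G E"
  \<comment> \<open>For \<open>m = 1\<close>, and for \<open>m = 0\<close> by the convention
    \<open>ln 0 = 0\<close>, the dimension bound is 0.\<close>
  define d where "d = (if m \<le> 1 then 0 else 2 * s + 1)"
  define good where "good \<tau> \<longleftrightarrow> output_dim \<tau> = d \<and>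
    separating_embedding n m ?R \<epsilon> d (- 1 / 2) (output_query \<tau>) (output_doc \<tau>)" for \<tau>
  have fin: "finite (?R i)" for i by (simp add: relevant_def)
  have E: "E i \<in> {1..m}" "E i \<in> ?R i" if "i \<in> {1..n}" for i
    using HR that by (auto simp: hierarchical_retrieval_def relevant_def)
  have dim: "real d \<le> 5 * max (real s * ln (real m)) (1 / \<epsilon>\<^sup>2 * ln (real m))"
  proof (cases "m \<le> 1")
    case True
    then have "m = 0 \<or> m = 1" by auto
    then show ?thesis by (auto simp: d_def)
  qed (use dim_bound[OF _ \<epsilon>] in \<open>auto simp: d_def\<close>)
  have "\<exists>T. real T \<le> soft_bound 124 0 (real m * real d + real n * real s * real d) \<and>
    (\<forall>\<omega>. runs embed_prog (initial_state n m ?R \<epsilon> s \<omega>) T good)"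
  proof (cases "m \<le> 1")
    case True
    have "{1..m} \<subseteq> ?R i" if "i \<in> {1..n}" for i
    proof
      fix j assume "j \<in> {1..m}"
      with E(1)[OF that] True have "j = E i" by auto
      with E(2)[OF that] show "j \<in> ?R i" by simp
    qed
    from runs_embed_prog_trivial[OF True this \<epsilon>(2)]
    have "\<forall>\<omega>. runs embed_prog (initial_state n m ?R \<epsilon> s \<omega>) 5 good"
      using True by (simp add: good_def[abs_def] d_def)
    \<comment> \<open>Here the argument of \<open>soft_bound\<close> is 0, and its
      \<open>max\<close> turns the bound into the constant 124.\<close>
    then show ?thesis using True by (intro exI[of _ 5]) (simp add: soft_bound_def d_def)
  next
    case False
    then have d: "d = 2 * s + 1" by (simp add: d_def)
    \<comment> \<open>The exact match is relevant to its query, so one query already forces a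
      nonempty relevant set.\<close>
    have "0 < s" if "0 < n"
    proof -
      have "1 \<in> {1..n}" using that by simp
      then have "0 < card (?R 1)" using E(2) fin by (auto simp: card_gt_0_iff)
      with card \<open>1 \<in> {1..n}\<close> show ?thesis by fastforce
    qed
    with False d have "real (m * (33 + d * 20) + n * (s * (d * 51 + 17) + d * 19 + 37) + 31)
        \<le> soft_bound 124 0 (real m * real d + real n * real s * real d)"
      by (intro time_bound) auto
    moreover have "runs embed_prog (initial_state n m ?R \<epsilon> s \<omega>)
        (m * (33 + d * 20) + n * (s * (d * 51 + 17) + d * 19 + 37) + 31) good" for \<omega>
      unfolding good_def[abs_def]
      by (rule runs_embed_prog) (use False card fin \<epsilon> d in auto)
    ultimately show ?thesis by blast
  qed
  then have ex: "\<exists>t \<sigma>. exec embed_prog (initial_state n m ?R \<epsilon> s \<omega>) t \<sigma> \<and> good \<sigma> \<and>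
      real t \<le> soft_bound 124 0 (real m * real d + real n * real s * real d)" for \<omega>
    unfolding runs_def by (meson of_nat_mono order.trans)
  \<comment> \<open>The program succeeds on every tape, so the event is the whole space and has
    probability 1.\<close>
  then have "{\<omega> \<in> space gaussian_tape. \<exists>t \<sigma>.
      exec embed_prog (initial_state n m ?R \<epsilon> s \<omega>) t \<sigma> \<and> good \<sigma>} = space gaussian_tape" by blast
  then have prob: "1 - 1 / real m ^ 1 \<le> measure gaussian_tape {\<omega> \<in> space gaussian_tape. \<exists>t \<sigma>.
      exec embed_prog (initial_state n m ?R \<epsilon> s \<omega>) t \<sigma> \<and> good \<sigma>}"
    by (simp add: prob_space.prob_space[OF prob_space_gaussian_tape])
  show "\<exists>(d::nat) (r::real).
      real d \<le> 5 * max (real s * ln (real m)) (1 / \<epsilon>\<^sup>2 * ln (real m)) \<and>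
      (\<exists>q x. separating_embedding n m ?R \<epsilon> d r q x) \<and>
      (\<forall>\<omega>. \<exists>t \<sigma>. exec embed_prog (initial_state n m ?R \<epsilon> s \<omega>) t \<sigma> \<and>
         real t \<le> soft_bound 124 0 (real m * real d + real n * real s * real d)) \<and>
      measure gaussian_tape
        {\<omega> \<in> space gaussian_tape. \<exists>t \<sigma>.
           exec embed_prog (initial_state n m ?R \<epsilon> s \<omega>) t \<sigma> \<and>
           output_dim \<sigma> = d \<and>
           separating_embedding n m ?R \<epsilon> d r (output_query \<sigma>) (output_doc \<sigma>)}
        \<ge> 1 - 1 / real m ^ 1"
  proof (intro exI[of _ d] exI[of _ "- 1 / 2"] conjI)
    \<comment> \<open>The output on any one tape, here the zero tape, serves as witness.\<close>
    show "\<exists>q x. separating_embedding n m ?R \<epsilon> d (- 1 / 2) q x"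
      using ex[of "\<lambda>_. 0"] unfolding good_def by blast
    show "\<forall>\<omega>. \<exists>t \<sigma>. exec embed_prog (initial_state n m ?R \<epsilon> s \<omega>) t \<sigma> \<and>
        real t \<le> soft_bound 124 0 (real m * real d + real n * real s * real d)"
      using ex by blast
  qed (use dim prob in \<open>simp_all only: good_def\<close>)
qed

end
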